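(* Let $m\ge1$, $n\ge m+1$, and let $\mathbf r=(r_1,\dots,r_n)$ be positive real numbers with $\Lambda=\frac1{m+1}\sum_ir_i$. Let $\Phi:M_{\mathbf r}\to\mathcal M_\Lambda$ be the Gel'fand–MacPherson duality isomorphism from the moduli space of closed polygons to the torus quotient of the Grassmannian orbit. Then $\Phi$ carries the Gel'fand–Tsetlin Hamiltonians to the bending Hamiltonians: $$\Phi^*\gamma_{i+1,j}=\lambda_{ij}\qquad(0\le i\le n-1,\ 1\le j\le\min(i+1,m+1)).$$
   Context: For a unit vector $w\in\mathbb C^{m+1}$, $w\otimes w^*$ is the projection $v\mapsto(v,w)w$; $\mathcal O_r=\{r\,w\otimes w^*:\|w\|=1\}$. $\widetilde M_{\mathbf r}=\{(e_1,\dots,e_n)\in\prod_i\mathcal O_{r_i}:\sum_ie_i=\Lambda\mathbb I\}$, $M_{\mathbf r}=\widetilde M_{\mathbf r}/U(m+1)$ (simultaneous conjugation). Bending Hamiltonians: $\lambda_{ij}$ is the $j$-th largest eigenvalue of $A_i=e_1+\cdots+e_{i+1}$. Let $\mathcal M_{\mathbf r,\Lambda}$ be the set of complex $(m+1)\times n$ matrices $N$ with columns $C_1,\dots,C_n$ such that $\|C_j\|^2=r_j$ for all $j$ and $NN^*=\Lambda\mathbb I_{m+1}$. $U(m+1)$ acts on it on the left and the torus $T$ of diagonal matrices in $U(n)$ on the right. The map $\pi_1:\mathcal M_{\mathbf r,\Lambda}\to M_{\mathbf r}$ sends $N$ to the class of $(C_1C_1^*,\dots,C_nC_n^* )$. Let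 $\mathcal O_\Lambda$ be the set of $n\times n$ Hermitian matrices with eigenvalue $\Lambda$ of multiplicity $m+1$ and eigenvalue $0$ of multiplicity $n-m-1$ (a copy of the Grassmannian), and $\mathcal M_\Lambda$ the quotient by $T$ (acting by conjugation) of the set of matrices in $\mathcal O_\Lambda$ with diagonal $(r_1,\dots,r_n)$. The map $\pi_2:\mathcal M_{\mathbf r,\Lambda}\to\mathcal M_\Lambda$ sends $N$ to the class of $N^*N$. Both $\pi_1$ and $\pi_2$ are the quotient maps by $U(m+1)\times T$, and $\Phi$ is the bijection determined by $\Phi(\pi_1(N))=\pi_2(N)$. Gel'fand–Tsetlin Hamiltonians: for an $n\times n$ Hermitian matrix $X$, $\gamma_{ij}(X)$ is the $j$-th largest eigenvalue of the upper-left $i\times i$ principal block of $X$; these functions are invariant under conjugation by $T$ and so descend to $\mathcal M_\Lambda$. *)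

theory Defs
  imports "Jordan_Normal_Form.Schur_Decomposition"
begin

text \<open>
  Throughout, \<open>n\<close>-tuples are lists of length \<open>n\<close> or functions on \<open>{..<n}\<close>, and indices of
  vectors, matrices and tuples start at 0, whereas eigenvalues are counted from 1.
  The ambient space is \<open>\<complex>\<^sup>m\<^sup>+\<^sup>1\<close>, of dimension \<open>Suc m\<close>.
\<close>

definition unitary_mats :: "nat \<Rightarrow> complex mat set" where
  "unitary_mats k = {U \<in> carrier_mat k k. mat_adjoint U * U = 1\<^sub>m k}"

definition torus :: "nat \<Rightarrow> complex mat set" where
  "torus n = {D \<in> unitary_mats n. diagonal_mat D}"

text \<open>The matrix \<open>w \<otimes> w\<^sup>*\<close> of the map \<open>v \<mapsto> (v, w) w\<close>, that is, \<open>w w\<^sup>*\<close> for a column vector \<open>w\<close>.\<close>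

definition tensor_star :: "complex vec \<Rightarrow> complex mat" where
  "tensor_star w = mat (dim_vec w) (dim_vec w) (\<lambda>(a, b). w $ a * cnj (w $ b))"

text \<open>
  The list of eigenvalues in decreasing order, repeated according to algebraic multiplicity.
  It is used for Hermitian matrices only, where all eigenvalues are real, so that \<open>Re\<close>
  loses nothing and algebraic and geometric multiplicities agree.
\<close>

definition eigenvalues_desc :: "complex mat \<Rightarrow> real list" where
  "eigenvalues_desc A = rev (sorted_list_of_multiset (image_mset Re (proots (char_poly A))))"

definition nth_largest_eigenvalue :: "complex mat \<Rightarrow> nat \<Rightarrow> real" where
  "nth_largest_eigenvalue A j = eigenvalues_desc A ! (j - 1)"

definition mat_sum_list :: "nat \<Rightarrow> complex mat list \<Rightarrow> complex mat" where
  "mat_sum_list k es = foldr (+) es (0\<^sub>m k k)"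


subsection \<open>Closed polygons\<close>

definition orbit :: "nat \<Rightarrow> real \<Rightarrow> complex mat set" where
  "orbit m \<rho> = {complex_of_real \<rho> \<cdot>\<^sub>m tensor_star w | w.
     w \<in> carrier_vec (Suc m) \<and> w \<bullet>c w = 1}"

definition closed_polygons ::
    "nat \<Rightarrow> nat \<Rightarrow> (nat \<Rightarrow> real) \<Rightarrow> real \<Rightarrow> complex mat list set" where
  "closed_polygons m n r \<Lambda> = {es. length es = n \<and> (\<forall>i<n. es ! i \<in> orbit m (r i)) \<and>
     mat_sum_list (Suc m) es = complex_of_real \<Lambda> \<cdot>\<^sub>m 1\<^sub>m (Suc m)}"

definition polygon_rel ::
    "nat \<Rightarrow> nat \<Rightarrow> (nat \<Rightarrow> real) \<Rightarrow> real \<Rightarrow> (complex mat list \<times> complex mat list) set" where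
  "polygon_rel m n r \<Lambda> = {(es, fs). es \<in> closed_polygons m n r \<Lambda> \<and>
     fs \<in> closed_polygons m n r \<Lambda> \<and>
     (\<exists>U \<in> unitary_mats (Suc m). fs = map (\<lambda>e. U * e * mat_adjoint U) es)}"

definition polygon_moduli ::
    "nat \<Rightarrow> nat \<Rightarrow> (nat \<Rightarrow> real) \<Rightarrow> real \<Rightarrow> complex mat list set set" where
  "polygon_moduli m n r \<Lambda> = closed_polygons m n r \<Lambda> // polygon_rel m n r \<Lambda>"

text \<open>
  The bending Hamiltonian \<open>\<lambda>\<^sub>i\<^sub>j\<close> on classes: the common value on all representatives.
  The partial sum \<open>A\<^sub>i = e\<^sub>1 + \<dots> + e\<^sub>i\<^sub>+\<^sub>1\<close> runs over the first \<open>i + 1\<close> list entries.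
\<close>

definition bending_hamiltonian :: "nat \<Rightarrow> nat \<Rightarrow> nat \<Rightarrow> complex mat list set \<Rightarrow> real" where
  "bending_hamiltonian m i j p =
     the_elem ((\<lambda>es. nth_largest_eigenvalue (mat_sum_list (Suc m) (take (Suc i) es)) j) ` p)"


subsection \<open>The torus quotient of the Grassmannian orbit\<close>

definition grassmannian_orbit :: "nat \<Rightarrow> nat \<Rightarrow> real \<Rightarrow> complex mat set" where
  "grassmannian_orbit m n \<Lambda> = {X \<in> carrier_mat n n. mat_adjoint X = X \<and>
     proots (char_poly X) =
       replicate_mset (m + 1) (complex_of_real \<Lambda>) + replicate_mset (n - m - 1) 0}"

definition diag_slice ::
    "nat \<Rightarrow> nat \<Rightarrow> (nat \<Rightarrow> real) \<Rightarrow> real \<Rightarrow> complex mat set" where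
  "diag_slice m n r \<Lambda> =
     {X \<in> grassmannian_orbit m n \<Lambda>. \<forall>i<n. X $$ (i, i) = complex_of_real (r i)}"

definition torus_rel ::
    "nat \<Rightarrow> nat \<Rightarrow> (nat \<Rightarrow> real) \<Rightarrow> real \<Rightarrow> (complex mat \<times> complex mat) set" where
  "torus_rel m n r \<Lambda> = {(X, Y). X \<in> diag_slice m n r \<Lambda> \<and> Y \<in> diag_slice m n r \<Lambda> \<and>
     (\<exists>D \<in> torus n. Y = D * X * mat_adjoint D)}"

definition torus_quotient ::
    "nat \<Rightarrow> nat \<Rightarrow> (nat \<Rightarrow> real) \<Rightarrow> real \<Rightarrow> complex mat set set" where
  "torus_quotient m n r \<Lambda> = diag_slice m n r \<Lambda> // torus_rel m n r \<Lambda>"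

definition upper_left_block :: "complex mat \<Rightarrow> nat \<Rightarrow> complex mat" where
  "upper_left_block X i = mat i i (\<lambda>(a, b). X $$ (a, b))"

text \<open>The Gel'fand-Tsetlin Hamiltonian \<open>\<gamma>\<^sub>i\<^sub>j\<close> on classes, as above.\<close>

definition GT_hamiltonian :: "nat \<Rightarrow> nat \<Rightarrow> complex mat set \<Rightarrow> real" where
  "GT_hamiltonian i j q =
     the_elem ((\<lambda>X. nth_largest_eigenvalue (upper_left_block X i) j) ` q)"


subsection \<open>Gel'fand-MacPherson duality\<close>

definition frame_mats ::
    "nat \<Rightarrow> nat \<Rightarrow> (nat \<Rightarrow> real) \<Rightarrow> real \<Rightarrow> complex mat set" where
  "frame_mats m n r \<Lambda> = {N \<in> carrier_mat (Suc m) n.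
     (\<forall>j<n. col N j \<bullet>c col N j = complex_of_real (r j)) \<and>
     N * mat_adjoint N = complex_of_real \<Lambda> \<cdot>\<^sub>m 1\<^sub>m (Suc m)}"

definition pi1 ::
    "nat \<Rightarrow> nat \<Rightarrow> (nat \<Rightarrow> real) \<Rightarrow> real \<Rightarrow> complex mat \<Rightarrow> complex mat list set" where
  "pi1 m n r \<Lambda> N = polygon_rel m n r \<Lambda> `` {map (\<lambda>j. tensor_star (col N j)) [0..<n]}"

definition pi2 ::
    "nat \<Rightarrow> nat \<Rightarrow> (nat \<Rightarrow> real) \<Rightarrow> real \<Rightarrow> complex mat \<Rightarrow> complex mat set" where
  "pi2 m n r \<Lambda> N = torus_rel m n r \<Lambda> `` {mat_adjoint N * N}"

text \<open>
  The map \<open>\<Phi>\<close> from \<open>polygon_moduli\<close> to \<open>torus_quotient\<close> determined by \<open>\<Phi> (\<pi>\<^sub>1 N) = \<pi>\<^sub>2 N\<close>: for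
  \<open>r > 0\<close> every \<open>p\<close> has a nonempty fibre under \<open>\<pi>\<^sub>1\<close> (\<open>pi1_image\<close>), on which \<open>\<pi>\<^sub>2\<close> is constant
  (\<open>pi2_eq\<close>).
\<close>

definition GM_duality ::
    "nat \<Rightarrow> nat \<Rightarrow> (nat \<Rightarrow> real) \<Rightarrow> real \<Rightarrow> complex mat list set \<Rightarrow> complex mat set" where
  "GM_duality m n r \<Lambda> p = the_elem (pi2 m n r \<Lambda> ` {N \<in> frame_mats m n r \<Lambda>. pi1 m n r \<Lambda> N = p})"


subsection \<open>Well-definedness of the duality map\<close>

lemma mat_adjoint_dims [simp]:
  "dim_row (mat_adjoint A) = dim_col A" "dim_col (mat_adjoint A) = dim_row A"
  by (simp_all add: mat_adjoint_def)

lemma mat_adjoint_carrier [simp]: "mat_adjoint A \<in> carrier_mat (dim_col A) (dim_row A)"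
  by (rule carrier_matI) simp_all

lemma mat_adjoint_index [simp]:
  fixes A :: "complex mat"
  assumes "i < dim_col A" "j < dim_row A"
  shows "mat_adjoint A $$ (i, j) = cnj (A $$ (j, i))"
  using assms by (simp add: mat_adjoint_def mat_of_rows_def)

lemma mat_adjoint_mult:
  fixes A B :: "complex mat"
  assumes "A \<in> carrier_mat a b" "B \<in> carrier_mat b c"
  shows "mat_adjoint (A * B) = mat_adjoint B * mat_adjoint A"
proof (rule eq_matI)
  fix i j
  assume "i < dim_row (mat_adjoint B * mat_adjoint A)" "j < dim_col (mat_adjoint B * mat_adjoint A)"
  then have "i < c" "j < a" using assms by auto
  then show "mat_adjoint (A * B) $$ (i, j) = (mat_adjoint B * mat_adjoint A) $$ (i, j)"
    using assms by (simp add: scalar_prod_def mult.commute)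
qed (use assms in auto)

lemma mat_adjoint_adjoint [simp]: "mat_adjoint (mat_adjoint A) = (A :: complex mat)"
  by (rule eq_matI) auto

lemma unitary_matsD:
  assumes "U \<in> unitary_mats k"
  shows "U \<in> carrier_mat k k" "mat_adjoint U \<in> carrier_mat k k"
    "mat_adjoint U * U = 1\<^sub>m k" "U * mat_adjoint U = 1\<^sub>m k"
proof -
  show U: "U \<in> carrier_mat k k" and l: "mat_adjoint U * U = 1\<^sub>m k"
    using assms by (auto simp: unitary_mats_def)
  show a: "mat_adjoint U \<in> carrier_mat k k"
    using U mat_adjoint_carrier[of U] by auto
  show "U * mat_adjoint U = 1\<^sub>m k"
    using mat_mult_left_right_inverse[OF a U l] .
qed

lemma unitary_adjoint: "U \<in> unitary_mats k \<Longrightarrow> mat_adjoint U \<in> unitary_mats k"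
  using unitary_matsD(2,4)[of U k] unfolding unitary_mats_def by simp

lemma unitary_mult:
  assumes "U \<in> unitary_mats k" "V \<in> unitary_mats k"
  shows "U * V \<in> unitary_mats k"
proof -
  note U = unitary_matsD[OF assms(1)] and V = unitary_matsD[OF assms(2)]
  have "mat_adjoint (U * V) * (U * V) = mat_adjoint V * (mat_adjoint U * U) * V"
    using U(1,2) V(1,2) by (simp add: mat_adjoint_mult assoc_mult_mat[of _ k k _ k _ k])
  also have "\<dots> = 1\<^sub>m k" using U V by simp
  finally show ?thesis using U(1) V(1) by (auto simp: unitary_mats_def)
qed

lemma unitary_one: "1\<^sub>m k \<in> unitary_mats k"
proof -
  have "mat_adjoint (1\<^sub>m k :: complex mat) = 1\<^sub>m k" by (rule eq_matI) auto
  then show ?thesis by (auto simp: unitary_mats_def)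
qed

lemma conj_conj:
  assumes "U \<in> unitary_mats k" "V \<in> unitary_mats k" "A \<in> carrier_mat k k"
  shows "U * (V * A * mat_adjoint V) * mat_adjoint U = (U * V) * A * mat_adjoint (U * V)"
proof -
  note U = unitary_matsD(1,2)[OF assms(1)] and V = unitary_matsD(1,2)[OF assms(2)]
  show ?thesis
    unfolding mat_adjoint_mult[OF U(1) V(1)] using U V assms(3)
    by (simp add: assoc_mult_mat[of _ k k _ k _ k])
qed

lemma conj_inv:
  assumes "U \<in> unitary_mats k" "A \<in> carrier_mat k k"
  shows "mat_adjoint U * (U * A * mat_adjoint U) * mat_adjoint (mat_adjoint U) = A"
proof -
  have "mat_adjoint (1\<^sub>m k :: complex mat) = 1\<^sub>m k" by (rule eq_matI) auto
  then show ?thesis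
    unfolding conj_conj[OF unitary_adjoint[OF assms(1)] assms] unitary_matsD(3)[OF assms(1)]
    using assms(2) by simp
qed

lemma diagonal_adjoint: "diagonal_mat D \<Longrightarrow> diagonal_mat (mat_adjoint (D :: complex mat))"
  by (auto simp: diagonal_mat_def)

lemma diagonal_mult:
  fixes D E :: "complex mat"
  assumes "diagonal_mat D" "diagonal_mat E" "D \<in> carrier_mat k k" "E \<in> carrier_mat k k"
  shows "diagonal_mat (D * E)"
proof -
  have "D $$ (i, l) * E $$ (l, j) = 0" if "i < k" "j < k" "i \<noteq> j" "l < k" for i j l
    using assms that unfolding diagonal_mat_def by (cases "i = l") auto
  then show ?thesis
    using assms(3,4) by (auto simp: diagonal_mat_def scalar_prod_def intro!: sum.neutral)
qed

lemma torus_adjoint: "D \<in> torus n \<Longrightarrow> mat_adjoint D \<in> torus n"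
  by (auto simp: torus_def unitary_adjoint diagonal_adjoint)

lemma torus_mult: "D \<in> torus n \<Longrightarrow> E \<in> torus n \<Longrightarrow> D * E \<in> torus n"
  using unitary_mult[of D n E] diagonal_mult[of D E n] unitary_matsD(1)[of D n] unitary_matsD(1)[of E n]
  by (simp add: torus_def)

lemma torus_one: "1\<^sub>m n \<in> torus n"
  by (auto simp: torus_def unitary_one diagonal_mat_def)

lemma equiv_torus_rel: "equiv (diag_slice m n r \<Lambda>) (torus_rel m n r \<Lambda>)"
proof (rule equivI)
  have c: "X \<in> carrier_mat n n" if "X \<in> diag_slice m n r \<Lambda>" for X
    using that by (auto simp: diag_slice_def grassmannian_orbit_def)
  have u: "D \<in> unitary_mats n" if "D \<in> torus n" for D using that by (simp add: torus_def)
  show "torus_rel m n r \<Lambda> \<subseteq> diag_slice m n r \<Lambda> \<times> diag_slice m n r \<Lambda>"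
    by (auto simp: torus_rel_def)
  show "refl_on (diag_slice m n r \<Lambda>) (torus_rel m n r \<Lambda>)"
  proof (rule refl_onI)
    fix X assume X: "X \<in> diag_slice m n r \<Lambda>"
    have "mat_adjoint (1\<^sub>m n :: complex mat) = 1\<^sub>m n" by (rule eq_matI) auto
    then have "X = 1\<^sub>m n * X * mat_adjoint (1\<^sub>m n)" using c[OF X] by simp
    then show "(X, X) \<in> torus_rel m n r \<Lambda>" using X torus_one unfolding torus_rel_def by blast
  qed
  show "sym (torus_rel m n r \<Lambda>)"
  proof (rule symI)
    fix X Y assume "(X, Y) \<in> torus_rel m n r \<Lambda>"
    then obtain D where D: "D \<in> torus n" "Y = D * X * mat_adjoint D"
      and XY: "X \<in> diag_slice m n r \<Lambda>" "Y \<in> diag_slice m n r \<Lambda>"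
      by (auto simp: torus_rel_def)
    then have "X = mat_adjoint D * Y * mat_adjoint (mat_adjoint D)"
      using conj_inv[OF u[OF D(1)] c[OF XY(1)]] by simp
    then show "(Y, X) \<in> torus_rel m n r \<Lambda>"
      using XY torus_adjoint[OF D(1)] unfolding torus_rel_def by blast
  qed
  show "trans (torus_rel m n r \<Lambda>)"
  proof (rule transI)
    fix X Y Z assume "(X, Y) \<in> torus_rel m n r \<Lambda>" "(Y, Z) \<in> torus_rel m n r \<Lambda>"
    then obtain D E where D: "D \<in> torus n" "Y = D * X * mat_adjoint D"
      and E: "E \<in> torus n" "Z = E * Y * mat_adjoint E"
      and XZ: "X \<in> diag_slice m n r \<Lambda>" "Z \<in> diag_slice m n r \<Lambda>"
      by (auto simp: torus_rel_def)
    then have "Z = (E * D) * X * mat_adjoint (E * D)"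
      using conj_conj[OF u[OF E(1)] u[OF D(1)] c[OF XZ(1)]] by simp
    then show "(X, Z) \<in> torus_rel m n r \<Lambda>"
      using XZ torus_mult[OF E(1) D(1)] unfolding torus_rel_def by blast
  qed
qed

lemma torus_conj_diag_slice:
  assumes X: "X \<in> diag_slice m n r \<Lambda>" and D: "D \<in> torus n"
  shows "D * X * mat_adjoint D \<in> diag_slice m n r \<Lambda>"
proof -
  have Xc: "X \<in> carrier_mat n n" and Xh: "mat_adjoint X = X"
    using X by (auto simp: diag_slice_def grassmannian_orbit_def)
  have Du: "D \<in> unitary_mats n" and Dd: "diagonal_mat D" using D by (auto simp: torus_def)
  note Dm = unitary_matsD[OF Du]
  let ?Y = "D * X * mat_adjoint D"
  have Yc: "?Y \<in> carrier_mat n n" using Xc Dm by auto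
  have h: "mat_adjoint ?Y = ?Y"
    using Xc Dm(1,2) Xh
    by (simp add: mat_adjoint_mult[of _ n n _ n] assoc_mult_mat[of _ n n _ n _ n])
  have "similar_mat ?Y X"
    by (rule similar_matI[of _ _ D "mat_adjoint D" n]) (use Dm Xc Yc in auto)
  then have cp: "char_poly ?Y = char_poly X" by (rule char_poly_similar)
  have "?Y $$ (i, i) = X $$ (i, i)" if i: "i < n" for i
  proof -
    have z: "D $$ (a, b) = 0" if "a < n" "b < n" "a \<noteq> b" for a b
      using Dd Dm(1) that by (auto simp: diagonal_mat_def)
    have DX: "(D * X) $$ (i, b) = D $$ (i, i) * X $$ (i, b)" if "b < n" for b
    proof -
      have "(D * X) $$ (i, b) = (\<Sum>a = 0..<n. D $$ (i, a) * X $$ (a, b))"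
        using that i Dm(1) Xc by (simp add: scalar_prod_def)
      also have "\<dots> = (\<Sum>a\<in>{i}. D $$ (i, a) * X $$ (a, b))"
        using i z by (intro sum.mono_neutral_right) auto
      finally show ?thesis by simp
    qed
    define P where "P = D * X"
    have "P \<in> carrier_mat n n" using Dm(1) Xc by (simp add: P_def)
    then have "(P * mat_adjoint D) $$ (i, i) = (\<Sum>b = 0..<n. P $$ (i, b) * mat_adjoint D $$ (b, i))"
      using i Dm(1,2) by (simp add: scalar_prod_def)
    then have "?Y $$ (i, i) = (\<Sum>b = 0..<n. (D * X) $$ (i, b) * mat_adjoint D $$ (b, i))"
      by (simp only: P_def)
    also have "\<dots> = (\<Sum>b\<in>{i}. (D * X) $$ (i, b) * mat_adjoint D $$ (b, i))"
      using i z Dm(1) by (intro sum.mono_neutral_right) auto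
    also have "\<dots> = X $$ (i, i) * (D $$ (i, i) * cnj (D $$ (i, i)))"
      using i DX Dm(1) by simp
    also have "D $$ (i, i) * cnj (D $$ (i, i)) = 1"
    proof -
      have "1 = (D * mat_adjoint D) $$ (i, i)" using Dm(4) i by simp
      also have "\<dots> = (\<Sum>b = 0..<n. D $$ (i, b) * cnj (D $$ (i, b)))"
        using i Dm(1) by (simp add: scalar_prod_def)
      also have "\<dots> = (\<Sum>b\<in>{i}. D $$ (i, b) * cnj (D $$ (i, b)))"
        using i z by (intro sum.mono_neutral_right) auto
      finally show ?thesis by simp
    qed
    finally show ?thesis by simp
  qed
  then show ?thesis using X h cp Yc by (auto simp: diag_slice_def grassmannian_orbit_def)
qed

lemma tensor_star_eq_phase:
  assumes eq: "tensor_star v = tensor_star w" and nz: "w \<bullet>c w \<noteq> 0"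
  shows "\<exists>c. c * cnj c = 1 \<and> v = c \<cdot>\<^sub>v w"
proof -
  define k where "k = dim_vec w"
  have dv: "dim_vec v = k" using arg_cong[OF eq, of dim_row] by (simp add: tensor_star_def k_def)
  have e: "v $ a * cnj (v $ b) = w $ a * cnj (w $ b)" if "a < k" "b < k" for a b
    using arg_cong[OF eq, of "\<lambda>M. M $$ (a, b)"] that dv by (simp add: tensor_star_def k_def)
  obtain b where b: "b < k" "w $ b \<noteq> 0"
    using nz by (force simp: scalar_prod_def k_def intro: sum.neutral)
  define c where "c = v $ b / w $ b"
  have bb: "v $ b * cnj (v $ b) = w $ b * cnj (w $ b)" using e[OF b(1) b(1)] .
  then have vb: "v $ b \<noteq> 0" using b by force
  have c1: "c * cnj c = 1" using bb b vb by (simp add: c_def)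
  have "v $ a = c * w $ a" if a: "a < k" for a
  proof -
    have "v $ a * cnj (v $ b) = w $ a * cnj (w $ b)" by (rule e[OF a b(1)])
    then have "v $ a * (cnj (v $ b) * w $ b) = w $ a * (w $ b * cnj (w $ b))"
      by (simp add: algebra_simps)
    also have "\<dots> = w $ a * v $ b * cnj (v $ b)" by (simp add: bb)
    finally have "v $ a * w $ b = w $ a * v $ b" using vb by simp
    then show ?thesis using b by (simp add: c_def field_simps)
  qed
  then have "v = c \<cdot>\<^sub>v w" using dv by (intro eq_vecI) (auto simp: k_def)
  then show ?thesis using c1 by blast
qed

lemma tensor_star_mult:
  assumes "U \<in> carrier_mat k k" "w \<in> carrier_vec k"
  shows "U * tensor_star w * mat_adjoint U = tensor_star (U *\<^sub>v w)"
proof (rule eq_matI)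
  fix i j assume "i < dim_row (tensor_star (U *\<^sub>v w))" "j < dim_col (tensor_star (U *\<^sub>v w))"
  then have ij: "i < k" "j < k" using assms by (auto simp: tensor_star_def)
  have "(U * tensor_star w * mat_adjoint U) $$ (i, j) =
      (\<Sum>b = 0..<k. (\<Sum>a = 0..<k. U $$ (i, a) * (w $ a * cnj (w $ b))) * cnj (U $$ (j, b)))"
    using ij assms by (simp add: scalar_prod_def tensor_star_def)
  also have "\<dots> = (\<Sum>b = 0..<k. \<Sum>a = 0..<k. (U $$ (i, a) * w $ a) * cnj (U $$ (j, b) * w $ b))"
    by (simp add: sum_distrib_right sum_distrib_left algebra_simps)
  also have "\<dots> = (\<Sum>a = 0..<k. \<Sum>b = 0..<k. (U $$ (i, a) * w $ a) * cnj (U $$ (j, b) * w $ b))"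
    by (rule sum.swap)
  also have "\<dots> = (\<Sum>a = 0..<k. U $$ (i, a) * w $ a) * cnj (\<Sum>b = 0..<k. U $$ (j, b) * w $ b)"
    by (simp add: sum_product)
  also have "\<dots> = tensor_star (U *\<^sub>v w) $$ (i, j)"
    using ij assms by (simp add: scalar_prod_def tensor_star_def)
  finally show "(U * tensor_star w * mat_adjoint U) $$ (i, j) = tensor_star (U *\<^sub>v w) $$ (i, j)" .
qed (use assms in \<open>auto simp: tensor_star_def\<close>)

lemma tensor_star_smult: "tensor_star (c \<cdot>\<^sub>v w) = (c * cnj c) \<cdot>\<^sub>m tensor_star w"
  by (rule eq_matI) (auto simp: tensor_star_def)

lemma mat_sum_list_carrier:
  "\<forall>e \<in> set es. e \<in> carrier_mat k k \<Longrightarrow> mat_sum_list k es \<in> carrier_mat k k"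
  by (induction es) (auto simp: mat_sum_list_def)

lemma mat_sum_list_index:
  assumes "\<forall>e \<in> set es. e \<in> carrier_mat k k" "a < k" "b < k"
  shows "mat_sum_list k es $$ (a, b) = (\<Sum>e\<leftarrow>es. e $$ (a, b))"
  using assms
proof (induction es)
  case (Cons e es)
  have "mat_sum_list k es \<in> carrier_mat k k" using Cons.prems by (auto intro: mat_sum_list_carrier)
  then have "mat_sum_list k (e # es) $$ (a, b) = e $$ (a, b) + mat_sum_list k es $$ (a, b)"
    using Cons.prems by (simp add: mat_sum_list_def)
  then show ?case using Cons by simp
qed (simp add: mat_sum_list_def)

lemma mat_sum_list_tensor_cols:
  assumes N: "N \<in> carrier_mat k n"
  shows "mat_sum_list k (map (\<lambda>j. tensor_star (col N j)) [0..<n]) = N * mat_adjoint N"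
proof -
  let ?es = "map (\<lambda>j. tensor_star (col N j)) [0..<n]"
  have c: "\<forall>e \<in> set ?es. e \<in> carrier_mat k k" using N by (auto simp: tensor_star_def)
  show ?thesis
  proof (rule eq_matI)
    fix a b assume "a < dim_row (N * mat_adjoint N)" "b < dim_col (N * mat_adjoint N)"
    then have ab: "a < k" "b < k" using N by auto
    have "mat_sum_list k ?es $$ (a, b) = (\<Sum>e\<leftarrow>?es. e $$ (a, b))"
      by (rule mat_sum_list_index[OF c ab])
    also have "\<dots> = (\<Sum>j\<leftarrow>[0..<n]. N $$ (a, j) * cnj (N $$ (b, j)))"
      using N ab by (intro arg_cong[of _ _ sum_list]) (auto simp: tensor_star_def)
    also have "\<dots> = (\<Sum>j = 0..<n. N $$ (a, j) * cnj (N $$ (b, j)))"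
      by (simp add: interv_sum_list_conv_sum_set_nat)
    also have "\<dots> = (N * mat_adjoint N) $$ (a, b)"
      using N ab by (simp add: scalar_prod_def)
    finally show "mat_sum_list k ?es $$ (a, b) = (N * mat_adjoint N) $$ (a, b)" .
  qed (use N mat_sum_list_carrier[OF c] in auto)
qed

lemma csqrt_smult_tensor:
  assumes "\<rho> \<ge> 0"
  shows "tensor_star (complex_of_real (sqrt \<rho>) \<cdot>\<^sub>v w) = complex_of_real \<rho> \<cdot>\<^sub>m tensor_star w"
proof -
  have "complex_of_real (sqrt \<rho>) * cnj (complex_of_real (sqrt \<rho>)) = complex_of_real (sqrt \<rho> * sqrt \<rho>)"
    by (simp only: of_real_mult complex_cnj_complex_of_real)
  also have "sqrt \<rho> * sqrt \<rho> = \<rho>" using assms by simp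
  finally show ?thesis unfolding tensor_star_smult by simp
qed

lemma cscalar_smult:
  "(c \<cdot>\<^sub>v w) \<bullet>c (c \<cdot>\<^sub>v w) = (c * cnj c) * ((w :: complex vec) \<bullet>c w)"
proof -
  have "(c \<cdot>\<^sub>v w) \<bullet>c (c \<cdot>\<^sub>v w) = (\<Sum>i = 0..<dim_vec w. (c * cnj c) * (w $ i * cnj (w $ i)))"
    unfolding scalar_prod_def by (rule sum.cong) auto
  also have "\<dots> = (c * cnj c) * (w \<bullet>c w)"
    unfolding scalar_prod_def sum_distrib_left by (rule sum.cong) auto
  finally show ?thesis .
qed

lemma frame_mats_closed_polygon:
  assumes N: "N \<in> frame_mats m n r \<Lambda>" and pos: "\<forall>i<n. r i > 0"
  shows "map (\<lambda>j. tensor_star (col N j)) [0..<n] \<in> closed_polygons m n r \<Lambda>"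
proof -
  have Nc: "N \<in> carrier_mat (Suc m) n"
    and cn: "\<And>j. j < n \<Longrightarrow> col N j \<bullet>c col N j = complex_of_real (r j)"
    and NN: "N * mat_adjoint N = complex_of_real \<Lambda> \<cdot>\<^sub>m 1\<^sub>m (Suc m)"
    using N by (auto simp: frame_mats_def)
  have "tensor_star (col N j) \<in> orbit m (r j)" if j: "j < n" for j
  proof -
    define s where "s = sqrt (r j)"
    have s: "s > 0" "s * s = r j" using pos j by (auto simp: s_def less_imp_le)
    define w where "w = complex_of_real (1 / s) \<cdot>\<^sub>v col N j"
    have "w \<bullet>c w = complex_of_real (1 / s) * complex_of_real (1 / s) * complex_of_real (r j)"
      unfolding w_def cscalar_smult cn[OF j] by simp
    also have "\<dots> = complex_of_real (1 / s * (1 / s) * (s * s))" by (simp only: s of_real_mult)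
    also have "\<dots> = 1" using s(1) by simp
    finally have w1: "w \<bullet>c w = 1" .
    have "complex_of_real (sqrt (r j)) \<cdot>\<^sub>v w = col N j"
      using s(1) by (intro eq_vecI) (auto simp: w_def s_def)
    then have "tensor_star (col N j) = complex_of_real (r j) \<cdot>\<^sub>m tensor_star w"
      using csqrt_smult_tensor[of "r j" w] pos j by (simp add: less_imp_le)
    moreover have "w \<in> carrier_vec (Suc m)" using Nc unfolding w_def
      by (simp only: smult_carrier_vec) (rule col_carrier_vec[OF j])
    ultimately show ?thesis using w1 unfolding orbit_def by blast
  qed
  then have "\<forall>i<n. map (\<lambda>j. tensor_star (col N j)) [0..<n] ! i \<in> orbit m (r i)" by simp
  moreover have "mat_sum_list (Suc m) (map (\<lambda>j. tensor_star (col N j)) [0..<n]) =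
      complex_of_real \<Lambda> \<cdot>\<^sub>m 1\<^sub>m (Suc m)"
    unfolding mat_sum_list_tensor_cols[OF Nc] by (rule NN)
  ultimately show ?thesis unfolding closed_polygons_def by simp
qed

lemma closed_polygon_frame_mats:
  assumes es: "es \<in> closed_polygons m n r \<Lambda>" and pos: "\<forall>i<n. r i > 0"
  shows "\<exists>N \<in> frame_mats m n r \<Lambda>. es = map (\<lambda>j. tensor_star (col N j)) [0..<n]"
proof -
  have len: "length es = n" and orb: "\<And>i. i < n \<Longrightarrow> es ! i \<in> orbit m (r i)"
    and su: "mat_sum_list (Suc m) es = complex_of_real \<Lambda> \<cdot>\<^sub>m 1\<^sub>m (Suc m)"
    using es by (auto simp: closed_polygons_def)
  have "\<forall>i. \<exists>w. i < n \<longrightarrow> es ! i = complex_of_real (r i) \<cdot>\<^sub>m tensor_star w \<and>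
      w \<in> carrier_vec (Suc m) \<and> w \<bullet>c w = 1"
    using orb unfolding orbit_def by blast
  then obtain w where w: "\<And>i. i < n \<Longrightarrow> es ! i = complex_of_real (r i) \<cdot>\<^sub>m tensor_star (w i)"
    and wc: "\<And>i. i < n \<Longrightarrow> w i \<in> carrier_vec (Suc m)" and w1: "\<And>i. i < n \<Longrightarrow> w i \<bullet>c w i = 1"
    by metis
  define c where "c i = complex_of_real (sqrt (r i)) \<cdot>\<^sub>v w i" for i
  define N where "N = mat_of_cols (Suc m) (map c [0..<n])"
  have Nc: "N \<in> carrier_mat (Suc m) n" by (auto simp: N_def)
  have col: "col N j = c j" if "j < n" for j
    using that wc[OF that] unfolding N_def by (subst col_mat_of_cols) (auto simp: c_def)
  have "es ! j = tensor_star (col N j)" if "j < n" for j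
    using that w[OF that] pos csqrt_smult_tensor[of "r j" "w j"] by (simp add: col c_def less_imp_le)
  then have eq: "es = map (\<lambda>j. tensor_star (col N j)) [0..<n]"
    using len by (intro nth_equalityI) auto
  have "col N j \<bullet>c col N j = complex_of_real (r j)" if "j < n" for j
  proof -
    have "col N j \<bullet>c col N j = complex_of_real (sqrt (r j)) * complex_of_real (sqrt (r j))"
      unfolding col[OF that] c_def cscalar_smult w1[OF that] by simp
    also have "\<dots> = complex_of_real (sqrt (r j) * sqrt (r j))" by (simp only: of_real_mult)
    also have "sqrt (r j) * sqrt (r j) = r j" using pos that by (simp add: less_imp_le)
    finally show ?thesis .
  qed
  moreover have "N * mat_adjoint N = complex_of_real \<Lambda> \<cdot>\<^sub>m 1\<^sub>m (Suc m)"
    using mat_sum_list_tensor_cols[OF Nc] su eq by simp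
  ultimately have "N \<in> frame_mats m n r \<Lambda>" using Nc by (auto simp: frame_mats_def)
  then show ?thesis using eq by blast
qed

lemma pi1_image: 
  assumes pos: "\<forall>i<n. r i > 0"
  shows "pi1 m n r \<Lambda> ` frame_mats m n r \<Lambda> = polygon_moduli m n r \<Lambda>"
proof
  show "pi1 m n r \<Lambda> ` frame_mats m n r \<Lambda> \<subseteq> polygon_moduli m n r \<Lambda>"
    using frame_mats_closed_polygon[OF _ pos] by (auto simp: pi1_def polygon_moduli_def intro: quotientI)
  show "polygon_moduli m n r \<Lambda> \<subseteq> pi1 m n r \<Lambda> ` frame_mats m n r \<Lambda>"
  proof
    fix p assume "p \<in> polygon_moduli m n r \<Lambda>"
    then obtain es where es: "es \<in> closed_polygons m n r \<Lambda>" "p = polygon_rel m n r \<Lambda> `` {es}"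
      unfolding polygon_moduli_def by (rule quotientE)
    obtain N where N: "N \<in> frame_mats m n r \<Lambda>" "es = map (\<lambda>j. tensor_star (col N j)) [0..<n]"
      using closed_polygon_frame_mats[OF es(1) pos] by blast
    have "p = pi1 m n r \<Lambda> N" unfolding es(2) pi1_def N(2) ..
    then show "p \<in> pi1 m n r \<Lambda> ` frame_mats m n r \<Lambda>" using N(1) by blast
  qed
qed

lemma pi1_fibre:
  assumes N: "N \<in> frame_mats m n r \<Lambda>" and N': "N' \<in> frame_mats m n r \<Lambda>"
    and eq: "pi1 m n r \<Lambda> N = pi1 m n r \<Lambda> N'" and pos: "\<forall>i<n. r i > 0"
  shows "\<exists>D \<in> torus n. mat_adjoint N' * N' = D * (mat_adjoint N * N) * mat_adjoint D"
proof -
  let ?e = "map (\<lambda>j. tensor_star (col N j)) [0..<n]"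
  let ?f = "map (\<lambda>j. tensor_star (col N' j)) [0..<n]"
  have Nc: "N \<in> carrier_mat (Suc m) n" and N'c: "N' \<in> carrier_mat (Suc m) n"
    and cn': "\<And>j. j < n \<Longrightarrow> col N j \<bullet>c col N j = complex_of_real (r j)"
    using N N' by (auto simp: frame_mats_def)
  have fc: "?f \<in> closed_polygons m n r \<Lambda>" by (rule frame_mats_closed_polygon[OF N' pos])
  have "(?f, ?f) \<in> polygon_rel m n r \<Lambda>"
  proof -
    have "mat_adjoint (1\<^sub>m (Suc m) :: complex mat) = 1\<^sub>m (Suc m)" by (rule eq_matI) auto
    then have "?f = map (\<lambda>e. 1\<^sub>m (Suc m) * e * mat_adjoint (1\<^sub>m (Suc m))) ?f"
      using N'c by (auto simp: tensor_star_def)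
    then show ?thesis using fc unitary_one[of "Suc m"] unfolding polygon_rel_def by blast
  qed
  then have "(?e, ?f) \<in> polygon_rel m n r \<Lambda>" using eq unfolding pi1_def by blast
  then obtain U where U: "U \<in> unitary_mats (Suc m)"
    and f: "?f = map (\<lambda>e. U * e * mat_adjoint U) ?e" by (auto simp: polygon_rel_def)
  note Um = unitary_matsD[OF U]
  have "tensor_star (col N' j) = tensor_star (U *\<^sub>v col N j)" if j: "j < n" for j
  proof -
    have "tensor_star (col N' j) = ?f ! j" using j by simp
    also have "\<dots> = U * tensor_star (col N j) * mat_adjoint U" unfolding f using j by simp
    also have "\<dots> = tensor_star (U *\<^sub>v col N j)"
      by (rule tensor_star_mult[OF Um(1) col_carrier_vec[OF j Nc]])
    finally show ?thesis .
  qed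
  moreover have "(U *\<^sub>v col N j) \<bullet>c (U *\<^sub>v col N j) \<noteq> 0" if j: "j < n" for j
  proof
    assume "(U *\<^sub>v col N j) \<bullet>c (U *\<^sub>v col N j) = 0"
    then have z: "U *\<^sub>v col N j = 0\<^sub>v (Suc m)"
      using conjugate_square_eq_0_vec[OF mult_mat_vec_carrier[OF Um(1) col_carrier_vec[OF j Nc]]]
      by blast
    have "col N j = mat_adjoint U * U *\<^sub>v col N j" using Um(3) Nc j by simp
    also have "\<dots> = mat_adjoint U *\<^sub>v (U *\<^sub>v col N j)"
      by (rule assoc_mult_mat_vec[OF Um(2,1) col_carrier_vec[OF j Nc]])
    also have "\<dots> = 0\<^sub>v (Suc m)" unfolding z using Um(2) by (intro eq_vecI) (auto simp: scalar_prod_def)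
    finally have "col N j \<bullet>c col N j = 0" by simp
    then show False using cn'[OF j] pos j by auto
  qed
  ultimately have "\<forall>j. \<exists>c. j < n \<longrightarrow> c * cnj c = 1 \<and> col N' j = c \<cdot>\<^sub>v (U *\<^sub>v col N j)"
    using tensor_star_eq_phase by metis
  then obtain c where c1: "\<And>j. j < n \<Longrightarrow> c j * cnj (c j) = 1"
    and c: "\<And>j. j < n \<Longrightarrow> col N' j = c j \<cdot>\<^sub>v (U *\<^sub>v col N j)" by metis
  define D where "D = mat n n (\<lambda>(i, j). if i = j then cnj (c i) else 0)"
  have Dc: "D \<in> carrier_mat n n" by (simp add: D_def)
  have aDc: "mat_adjoint D \<in> carrier_mat n n" using mat_adjoint_carrier[of D] Dc by auto
  have "mat_adjoint D * D = 1\<^sub>m n"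
  proof (rule eq_matI)
    fix i j assume "i < dim_row (1\<^sub>m n :: complex mat)" "j < dim_col (1\<^sub>m n :: complex mat)"
    then have ij: "i < n" "j < n" by auto
    have "(mat_adjoint D * D) $$ (i, j) = (\<Sum>k = 0..<n. cnj (D $$ (k, i)) * D $$ (k, j))"
      using ij Dc by (simp add: scalar_prod_def)
    also have "\<dots> = (\<Sum>k\<in>{i}. cnj (D $$ (k, i)) * D $$ (k, j))"
      using ij by (intro sum.mono_neutral_right) (auto simp: D_def)
    also have "\<dots> = 1\<^sub>m n $$ (i, j)" using ij c1 by (auto simp: D_def mult.commute)
    finally show "(mat_adjoint D * D) $$ (i, j) = 1\<^sub>m n $$ (i, j)" .
  qed (use Dc in auto)
  then have DT: "D \<in> torus n" using Dc by (auto simp: torus_def unitary_mats_def diagonal_mat_def D_def)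
  define W where "W = U * N"
  have Wc: "W \<in> carrier_mat (Suc m) n" using Um(1) Nc by (simp add: W_def)
  have aWc: "mat_adjoint W \<in> carrier_mat n (Suc m)" using mat_adjoint_carrier[of W] unfolding carrier_matD[OF Wc] .
  have aNc: "mat_adjoint N \<in> carrier_mat n (Suc m)" using mat_adjoint_carrier[of N] Nc by auto
  have NW: "N' = W * mat_adjoint D"
  proof (rule eq_matI)
    fix a j assume "a < dim_row (W * mat_adjoint D)" "j < dim_col (W * mat_adjoint D)"
    then have aj: "a < Suc m" "j < n" using Wc Dc by auto
    have "(W * mat_adjoint D) $$ (a, j) = (\<Sum>k = 0..<n. W $$ (a, k) * cnj (D $$ (j, k)))"
      using aj Wc Dc by (simp add: scalar_prod_def)
    also have "\<dots> = (\<Sum>k\<in>{j}. W $$ (a, k) * cnj (D $$ (j, k)))"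
      using aj by (intro sum.mono_neutral_right) (auto simp: D_def)
    also have "\<dots> = c j * W $$ (a, j)" using aj by (simp add: D_def)
    also have "\<dots> = (c j \<cdot>\<^sub>v (U *\<^sub>v col N j)) $ a" using aj Um(1) Nc by (simp add: W_def)
    also have "\<dots> = N' $$ (a, j)" using aj N'c by (simp flip: c)
    finally show "N' $$ (a, j) = (W * mat_adjoint D) $$ (a, j)" by simp
  qed (use N'c Wc Dc in auto)
  have WW: "mat_adjoint W * W = mat_adjoint N * N"
  proof -
    have "mat_adjoint W * W = mat_adjoint N * (mat_adjoint U * (U * N))"
      unfolding W_def mat_adjoint_mult[OF Um(1) Nc]
      using Um(1,2) Nc aNc by (simp add: assoc_mult_mat[of _ n "Suc m" _ "Suc m" _ n])
    also have "mat_adjoint U * (U * N) = (mat_adjoint U * U) * N"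
      using Um(1,2) Nc by (simp add: assoc_mult_mat[of _ "Suc m" "Suc m" _ "Suc m" _ n])
    also have "\<dots> = N" using Um(3) Nc by simp
    finally show ?thesis .
  qed
  have "mat_adjoint N' * N' = D * mat_adjoint W * (W * mat_adjoint D)"
    unfolding NW mat_adjoint_mult[OF Wc aDc] by simp
  also have "\<dots> = D * (mat_adjoint W * (W * mat_adjoint D))"
    by (rule assoc_mult_mat[OF Dc aWc]) (use Wc aDc in auto)
  also have "mat_adjoint W * (W * mat_adjoint D) = (mat_adjoint N * N) * mat_adjoint D"
    unfolding WW[symmetric] by (rule assoc_mult_mat[OF aWc Wc aDc, symmetric])
  also have "D * \<dots> = D * (mat_adjoint N * N) * mat_adjoint D"
    by (rule assoc_mult_mat[OF Dc _ aDc, symmetric]) (use Nc aNc in auto)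
  finally show ?thesis using DT by blast
qed

lemma pi2_eq:
  assumes "N \<in> frame_mats m n r \<Lambda>" "N' \<in> frame_mats m n r \<Lambda>"
    and "pi1 m n r \<Lambda> N = pi1 m n r \<Lambda> N'" and "\<forall>i<n. r i > 0"
  shows "pi2 m n r \<Lambda> N = pi2 m n r \<Lambda> N'"
proof -
  obtain D where D: "D \<in> torus n"
    and eq: "mat_adjoint N' * N' = D * (mat_adjoint N * N) * mat_adjoint D"
    using pi1_fibre[OF assms] by blast
  obtain E where E: "E \<in> torus n"
    and eq': "mat_adjoint N * N = E * (mat_adjoint N' * N') * mat_adjoint E"
    using pi1_fibre[OF assms(2,1) assms(3)[symmetric] assms(4)] by blast
  show ?thesis
  proof (cases "mat_adjoint N * N \<in> diag_slice m n r \<Lambda>")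
    case True
    then have "mat_adjoint N' * N' \<in> diag_slice m n r \<Lambda>"
      using torus_conj_diag_slice[OF _ D] eq by simp
    then have "(mat_adjoint N * N, mat_adjoint N' * N') \<in> torus_rel m n r \<Lambda>"
      using True D eq unfolding torus_rel_def by blast
    then show ?thesis unfolding pi2_def by (rule equiv_class_eq[OF equiv_torus_rel])
  next
    case False
    then have "mat_adjoint N' * N' \<notin> diag_slice m n r \<Lambda>"
      using torus_conj_diag_slice[OF _ E] eq' by metis
    with False show ?thesis unfolding pi2_def torus_rel_def by blast
  qed
qed

theorem GM_duality_pi1:
  assumes "N \<in> frame_mats m n r \<Lambda>" and "\<forall>i<n. r i > 0"
  shows "GM_duality m n r \<Lambda> (pi1 m n r \<Lambda> N) = pi2 m n r \<Lambda> N"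
proof -
  have "pi2 m n r \<Lambda> ` {N' \<in> frame_mats m n r \<Lambda>. pi1 m n r \<Lambda> N' = pi1 m n r \<Lambda> N} = {pi2 m n r \<Lambda> N}"
    using assms pi2_eq[OF _ assms(1) _ assms(2)] by blast
  then show ?thesis by (simp add: GM_duality_def)
qed

end

theory Submission
  imports Defs
begin

text \<open>
  Let \<open>B\<close> consist of the first \<open>i + 1\<close> columns of a frame \<open>N\<close>. The partial sum \<open>A\<^sub>i\<close> of the polygon
  of \<open>N\<close> is \<open>B B\<^sup>*\<close>, and the upper-left block of \<open>N\<^sup>* N\<close> of size \<open>i + 1\<close> is \<open>B\<^sup>* B\<close>. Both are
  positive semidefinite, and their characteristic polynomials agree up to a power of the variable
  (Sylvester's identity), so their decreasing eigenvalue lists agree up to trailing zeros.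
\<close>

section \<open>Spectra of \<open>A * B\<close> and \<open>B * A\<close>\<close>

lemma char_poly_zero_mat: "char_poly (0\<^sub>m k k :: 'a :: idom mat) = [:0, 1:] ^ k"
proof -
  have "diag_mat (0\<^sub>m k k :: 'a mat) = replicate k 0"
    by (rule nth_equalityI) (auto simp: diag_mat_def)
  moreover have "upper_triangular (0\<^sub>m k k :: 'a mat)" by auto
  ultimately show ?thesis
    using char_poly_upper_triangular[of "0\<^sub>m k k :: 'a mat" k] by simp
qed

text \<open>Sylvester's identity: \<open>(AB, 0; B, 0)\<close> and \<open>(0, 0; B, BA)\<close> are conjugate by \<open>(1, A; 0, 1)\<close>.\<close>

lemma char_poly_mult_commute:
  fixes A B :: "complex mat"
  assumes A: "A \<in> carrier_mat p q" and B: "B \<in> carrier_mat q p"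
  shows "char_poly (A * B) * [:0, 1:] ^ q = [:0, 1:] ^ p * char_poly (B * A)"
proof -
  define L where "L = four_block_mat (A * B) (0\<^sub>m p q) B (0\<^sub>m q q)"
  define R where "R = four_block_mat (0\<^sub>m p p) (0\<^sub>m p q) B (B * A)"
  define S where "S = four_block_mat (1\<^sub>m p) A (0\<^sub>m q p) (1\<^sub>m q)"
  define T where "T = four_block_mat (1\<^sub>m p) (- A) (0\<^sub>m q p) (1\<^sub>m q)"
  have AB: "A * B \<in> carrier_mat p p" and BA: "B * A \<in> carrier_mat q q" using A B by auto
  have mA: "- A \<in> carrier_mat p q" using A by simp
  have c: "{L, R, S, T} \<subseteq> carrier_mat (p + q) (p + q)"
    using A B by (auto simp: L_def R_def S_def T_def)
  have "- 0\<^sub>m q q = (0\<^sub>m q q :: complex mat)" by (rule eq_matI) auto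
  then have ST: "S * T = 1\<^sub>m (p + q)"
    unfolding S_def T_def
    by (subst mult_four_block_mat[OF one_carrier_mat A zero_carrier_mat one_carrier_mat
          one_carrier_mat mA zero_carrier_mat one_carrier_mat])
      (use A in \<open>simp add: uminus_l_inv_mat[OF A]\<close>)
  have TS: "T * S = 1\<^sub>m (p + q)"
    using mat_mult_left_right_inverse[OF _ _ ST] c by auto
  \<comment> \<open>The conjugacy is checked in the form \<open>S * R = L * S\<close>, which needs
    only products of two block matrices. Multiplying on the right by the inverse \<open>T\<close> of
    \<open>S\<close> then gives \<open>S * R * T = L\<close>.\<close>
  have "S * R = four_block_mat (A * B) (A * (B * A)) B (B * A)"
    unfolding S_def R_def
    by (subst mult_four_block_mat[OF one_carrier_mat A zero_carrier_mat one_carrier_mat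
          zero_carrier_mat zero_carrier_mat B BA])
      (use A B AB BA in simp)
  moreover have "L * S = four_block_mat (A * B) (A * (B * A)) B (B * A)"
    unfolding L_def S_def
    by (subst mult_four_block_mat[OF AB zero_carrier_mat B zero_carrier_mat
          one_carrier_mat A zero_carrier_mat one_carrier_mat])
      (use A B AB BA in \<open>simp add: assoc_mult_mat[OF A B A]\<close>)
  ultimately have "S * R * T = L * S * T" by simp
  also have "\<dots> = L * (S * T)" using c by (intro assoc_mult_mat) auto
  also have "\<dots> = L" unfolding ST using c by (intro right_mult_one_mat) auto
  finally have "similar_mat L R"
    using c ST TS by (intro similar_matI[of _ _ S T "p + q"]) auto
  then have "char_poly L = char_poly R" by (rule char_poly_similar)
  \<comment> \<open>The rule for block triangular matrices asks that the characteristic polynomials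
    of the diagonal blocks split into linear factors, which holds over the complex numbers.\<close>
  moreover have fac: "\<exists>es. char_poly M = (\<Prod>a\<leftarrow>es. [:- a, 1:])" if "M \<in> carrier_mat k k"
    for M :: "complex mat" and k
    using char_poly_factorized[OF that] by blast
  have "char_poly L = char_poly (A * B) * char_poly (0\<^sub>m q q)"
    by (rule char_poly_0_block'[OF L_def fac[OF AB] fac[OF zero_carrier_mat] AB B zero_carrier_mat])
  moreover have "char_poly R = char_poly (0\<^sub>m p p) * char_poly (B * A)"
    by (rule char_poly_0_block'[OF R_def fac[OF zero_carrier_mat] fac[OF BA] zero_carrier_mat B BA])
  ultimately show ?thesis by (simp add: char_poly_zero_mat)
qed

lemma char_poly_nonzero: "A \<in> carrier_mat k k \<Longrightarrow> char_poly A \<noteq> (0 :: complex poly)"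
  using degree_monic_char_poly[of A k] by force

text \<open>Root multisets of the two sides of Sylvester's identity. Zeros are added on both sides
  instead of being subtracted on one, so \<open>p\<close> and \<open>q\<close> need not be
  compared.\<close>

lemma proots_char_poly_mult_commute:
  fixes A B :: "complex mat"
  assumes A: "A \<in> carrier_mat p q" and B: "B \<in> carrier_mat q p"
  shows "proots (char_poly (A * B)) + replicate_mset q 0 =
    proots (char_poly (B * A)) + replicate_mset p 0"
proof -
  have nz: "char_poly (A * B) \<noteq> 0" "char_poly (B * A) \<noteq> 0"
    using A B by (auto intro!: char_poly_nonzero)
  have X: "proots ([:0, 1:] ^ k :: complex poly) = replicate_mset k 0" for k
    by (simp add: proots_power)
  have "proots (char_poly (A * B) * [:0, 1:] ^ q) = proots ([:0, 1:] ^ p * char_poly (B * A))"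
    by (simp only: char_poly_mult_commute[OF A B])
  then show ?thesis using nz by (simp add: proots_mult X add.commute)
qed

section \<open>Decreasing eigenvalue lists of Gram matrices\<close>

lemma mult_mat_vec_adjoint:
  fixes A :: "complex mat"
  assumes A: "A \<in> carrier_mat p q" and v: "v \<in> carrier_vec q" and w: "w \<in> carrier_vec p"
  shows "(mat_adjoint A *\<^sub>v w) \<bullet>c v = w \<bullet>c (A *\<^sub>v v)"
proof -
  have "(mat_adjoint A *\<^sub>v w) \<bullet>c v =
      (\<Sum>b = 0..<q. \<Sum>a = 0..<p. cnj (A $$ (a, b)) * w $ a * cnj (v $ b))"
    using A v w by (simp add: scalar_prod_def sum_distrib_right)
  also have "\<dots> = (\<Sum>a = 0..<p. \<Sum>b = 0..<q. cnj (A $$ (a, b)) * w $ a * cnj (v $ b))"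
    by (rule sum.swap)
  also have "\<dots> = w \<bullet>c (A *\<^sub>v v)"
    using A v w by (simp add: scalar_prod_def sum_distrib_left mult.assoc mult.left_commute)
  finally show ?thesis .
qed

text \<open>An eigenvector \<open>v\<close> for \<open>x\<close> satisfies
  \<open>x * (v \<bullet>c v) = (A v) \<bullet>c (A v)\<close>, and the right-hand side is a squared
  norm.\<close>

lemma proots_gram_nonneg:
  fixes A :: "complex mat"
  assumes A: "A \<in> carrier_mat p q" and x: "x \<in># proots (char_poly (mat_adjoint A * A))"
  shows "Re x \<ge> 0"
proof -
  have Aa: "mat_adjoint A \<in> carrier_mat q p" using mat_adjoint_carrier[of A] A by auto
  have G: "mat_adjoint A * A \<in> carrier_mat q q" using A Aa by auto
  have "eigenvalue (mat_adjoint A * A) x"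
    using x char_poly_nonzero[OF G] by (simp add: eigenvalue_root_char_poly[OF G])
  then obtain v where v: "v \<in> carrier_vec q" "v \<noteq> 0\<^sub>v q" "mat_adjoint A * A *\<^sub>v v = x \<cdot>\<^sub>v v"
    using G by (auto simp: eigenvalue_def eigenvector_def)
  have "x * (v \<bullet>c v) = (mat_adjoint A *\<^sub>v (A *\<^sub>v v)) \<bullet>c v"
    using v(1) by (simp flip: v(3) assoc_mult_mat_vec[OF Aa A v(1)])
       (simp add: v(3))
  also have "\<dots> = (A *\<^sub>v v) \<bullet>c (A *\<^sub>v v)"
    using A v(1) by (intro mult_mat_vec_adjoint) auto
  also have "\<dots> \<ge> 0" by (rule conjugate_square_ge_0_vec)
  finally have "x * (v \<bullet>c v) \<ge> 0" .
  \<comment> \<open>In the order on complex numbers this makes \<open>v \<bullet>c v\<close> a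
    positive real number, so \<open>Re x\<close> has the same sign as the real part of the
    product.\<close>
  moreover have "v \<bullet>c v > 0" using v by simp
  ultimately show ?thesis
    by (auto simp: less_eq_complex_def less_complex_def zero_le_mult_iff)
qed

text \<open>Nonnegativity is what sends the extra zeros to the end of the decreasing list. A
  negative eigenvalue would come after them and change its position.\<close>

lemma eigenvalues_desc_append_zeros:
  assumes eq: "proots (char_poly A) = proots (char_poly B) + replicate_mset d 0"
    and nonneg: "\<And>x. x \<in># proots (char_poly B) \<Longrightarrow> Re x \<ge> 0"
  shows "eigenvalues_desc A = eigenvalues_desc B @ replicate d 0"
proof -
  define M where "M = image_mset Re (proots (char_poly B))"
  \<comment> \<open>The underlying sorted list is increasing, so here the zeros stand in front; the
    reversal in \<open>eigenvalues_desc\<close> moves them to the back.\<close>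
  have "sorted (replicate d 0 @ sorted_list_of_multiset M)"
    using nonneg by (auto simp: sorted_append M_def)
  moreover have "mset (replicate d 0 @ sorted_list_of_multiset M) =
      image_mset Re (proots (char_poly A))"
    by (simp add: eq M_def)
  ultimately have "sorted_list_of_multiset (image_mset Re (proots (char_poly A))) =
      replicate d 0 @ sorted_list_of_multiset M"
    by (metis sorted_list_of_multiset_mset sort_key_id_if_sorted sorted_sort_id)
  then show ?thesis by (simp add: eigenvalues_desc_def M_def)
qed

lemma length_eigenvalues_desc:
  assumes "A \<in> carrier_mat k k"
  shows "length (eigenvalues_desc A) = k"
proof -
  have "length (eigenvalues_desc A) = size (proots (char_poly A))"
    unfolding eigenvalues_desc_def by (metis length_rev mset_sorted_list_of_multiset size_image_mset size_mset)
  then show ?thesis using degree_monic_char_poly[OF assms] by (simp add: size_proots_complex)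
qed

lemma replicate_mset_diff:
  "p \<le> q \<Longrightarrow> replicate_mset (q - p) x + replicate_mset p x = replicate_mset q x"
  by (rule multiset_eqI) simp

lemma nth_largest_eigenvalue_gram_le:
  fixes A :: "complex mat"
  assumes A: "A \<in> carrier_mat p q" and "p \<le> q" "1 \<le> j" "j \<le> p"
  shows "nth_largest_eigenvalue (mat_adjoint A * A) j =
    nth_largest_eigenvalue (A * mat_adjoint A) j"
proof -
  have Aa: "mat_adjoint A \<in> carrier_mat q p" using mat_adjoint_carrier[of A] A by auto
  \<comment> \<open>The \<open>q\<close> zeros supplied by Sylvester's identity are split as
    \<open>(q - p) + p\<close>, so that \<open>p\<close> of them cancel.\<close>
  have "proots (char_poly (mat_adjoint A * A)) + replicate_mset p 0 =
      proots (char_poly (A * mat_adjoint A)) + replicate_mset (q - p) 0 + replicate_mset p 0"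
    unfolding proots_char_poly_mult_commute[OF Aa A] add.assoc replicate_mset_diff[OF \<open>p \<le> q\<close>] ..
  then have "proots (char_poly (mat_adjoint A * A)) =
      proots (char_poly (A * mat_adjoint A)) + replicate_mset (q - p) 0"
    by simp
  moreover have "Re x \<ge> 0" if "x \<in># proots (char_poly (A * mat_adjoint A))" for x
    using proots_gram_nonneg[OF Aa] that by simp
  ultimately have "eigenvalues_desc (mat_adjoint A * A) =
      eigenvalues_desc (A * mat_adjoint A) @ replicate (q - p) 0"
    by (rule eigenvalues_desc_append_zeros)
  moreover have "length (eigenvalues_desc (A * mat_adjoint A)) = p"
    using A Aa by (intro length_eigenvalues_desc) auto
  \<comment> \<open>Eigenvalues are counted from 1 and list positions from 0: the
    \<open>j\<close>-th eigenvalue lies in the prefix of length \<open>p\<close>, before the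
    appended zeros.\<close>
  moreover have "j - 1 < p" using assms(3,4) by linarith
  ultimately show ?thesis by (simp add: nth_largest_eigenvalue_def nth_append)
qed

text \<open>For \<open>p > q\<close> the previous case applies to the adjoint of \<open>A\<close>,
  which exchanges the two Gram matrices.\<close>

lemma nth_largest_eigenvalue_gram:
  fixes A :: "complex mat"
  assumes A: "A \<in> carrier_mat p q" and "1 \<le> j" "j \<le> min p q"
  shows "nth_largest_eigenvalue (mat_adjoint A * A) j =
    nth_largest_eigenvalue (A * mat_adjoint A) j"
proof (cases "p \<le> q")
  case True
  then show ?thesis using nth_largest_eigenvalue_gram_le[OF A] assms by simp
next
  case False
  moreover have "mat_adjoint A \<in> carrier_mat q p" using mat_adjoint_carrier[of A] A by auto
  ultimately show ?thesis
    using nth_largest_eigenvalue_gram_le[of "mat_adjoint A" q p j] assms by simp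
qed

section \<open>Values of the two Hamiltonians on classes\<close>

lemma nth_largest_eigenvalue_similar:
  "similar_mat A B \<Longrightarrow> nth_largest_eigenvalue A j = nth_largest_eigenvalue B j"
  by (simp add: nth_largest_eigenvalue_def eigenvalues_desc_def char_poly_similar)

lemma similar_mat_unitary_conj:
  assumes U: "U \<in> unitary_mats k" and A: "A \<in> carrier_mat k k"
  shows "similar_mat (U * A * mat_adjoint U) A"
  by (rule similar_matI[of _ _ U "mat_adjoint U" k]) (use unitary_matsD[OF U] A in auto)

lemma mat_sum_list_conj:
  assumes U: "U \<in> carrier_mat k k" and V: "V \<in> carrier_mat k k"
    and "\<forall>e \<in> set es. e \<in> carrier_mat k k"
  shows "mat_sum_list k (map (\<lambda>e. U * e * V) es) = U * mat_sum_list k es * V"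
  using assms(3)
proof (induction es)
  case Nil
  then show ?case using U V by (simp add: mat_sum_list_def)
next
  case (Cons e es)
  have e: "e \<in> carrier_mat k k" and S: "mat_sum_list k es \<in> carrier_mat k k"
    using Cons.prems by (auto intro: mat_sum_list_carrier)
  have "U * mat_sum_list k (e # es) * V = U * (e + mat_sum_list k es) * V"
    by (simp add: mat_sum_list_def)
  also have "\<dots> = U * e * V + U * mat_sum_list k es * V"
    using U V e S by (simp add: mult_add_distrib_mat[OF U e S] add_mult_distrib_mat[of _ k k _ V k])
  also have "U * mat_sum_list k es * V = mat_sum_list k (map (\<lambda>e. U * e * V) es)"
    using Cons by simp
  finally show ?case by (simp add: mat_sum_list_def)
qed

lemma closed_polygons_carrier:
  "es \<in> closed_polygons m n r \<Lambda> \<Longrightarrow> \<forall>e \<in> set es. e \<in> carrier_mat (Suc m) (Suc m)"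
  by (force simp: closed_polygons_def orbit_def tensor_star_def in_set_conv_nth)

text \<open>Evaluates \<open>the_elem\<close> at a representative: conjugating every edge by
  \<open>U\<close> conjugates each partial sum by \<open>U\<close>, so the eigenvalues agree on the
  whole class.\<close>

lemma bending_hamiltonian_class:
  assumes es: "es \<in> closed_polygons m n r \<Lambda>"
  shows "bending_hamiltonian m i j (polygon_rel m n r \<Lambda> `` {es}) =
    nth_largest_eigenvalue (mat_sum_list (Suc m) (take (Suc i) es)) j"
proof -
  let ?f = "\<lambda>es. nth_largest_eigenvalue (mat_sum_list (Suc m) (take (Suc i) es)) j"
  have c: "\<forall>e \<in> set (take (Suc i) es). e \<in> carrier_mat (Suc m) (Suc m)"
    using closed_polygons_carrier[OF es] by (auto dest: in_set_takeD)
  have "?f fs = ?f es" if "(es, fs) \<in> polygon_rel m n r \<Lambda>" for fs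
  proof -
    obtain U where U: "U \<in> unitary_mats (Suc m)" and fs: "fs = map (\<lambda>e. U * e * mat_adjoint U) es"
      using \<open>(es, fs) \<in> polygon_rel m n r \<Lambda>\<close> by (auto simp: polygon_rel_def)
    have "mat_sum_list (Suc m) (take (Suc i) fs) =
        U * mat_sum_list (Suc m) (take (Suc i) es) * mat_adjoint U"
      unfolding fs take_map by (rule mat_sum_list_conj[OF unitary_matsD(1,2)[OF U] c])
    then show ?thesis
      using similar_mat_unitary_conj[OF U mat_sum_list_carrier[OF c]]
      by (simp add: nth_largest_eigenvalue_similar)
  qed
  \<comment> \<open>The class contains \<open>es\<close> itself, so the image is a singleton and not
    empty.\<close>
  moreover have "(es, es) \<in> polygon_rel m n r \<Lambda>"
  proof -
    have "mat_adjoint (1\<^sub>m (Suc m) :: complex mat) = 1\<^sub>m (Suc m)" by (rule eq_matI) auto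
    then have "es = map (\<lambda>e. 1\<^sub>m (Suc m) * e * mat_adjoint (1\<^sub>m (Suc m))) es"
      using closed_polygons_carrier[OF es] by (auto intro!: map_idI[symmetric])
    then show ?thesis using es unitary_one[of "Suc m"] unfolding polygon_rel_def by blast
  qed
  ultimately have "?f ` (polygon_rel m n r \<Lambda> `` {es}) = {?f es}" by blast
  then show ?thesis by (simp add: bending_hamiltonian_def)
qed

lemma mult_diagonal_mat_index:
  assumes D: "D \<in> carrier_mat n n" "diagonal_mat D" and X: "X \<in> carrier_mat n n"
    and "a < n" "b < n"
  shows "(D * X) $$ (a, b) = D $$ (a, a) * X $$ (a, b)" "(X * D) $$ (a, b) = X $$ (a, b) * D $$ (b, b)"
proof -
  have z: "D $$ (c, d) = 0" if "c < n" "d < n" "c \<noteq> d" for c d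
    using D that by (auto simp: diagonal_mat_def)
  have "(D * X) $$ (a, b) = (\<Sum>c\<in>{0..<n}. D $$ (a, c) * X $$ (c, b))"
    using assms by (simp add: scalar_prod_def)
  also have "\<dots> = (\<Sum>c\<in>{a}. D $$ (a, c) * X $$ (c, b))"
    using assms z by (intro sum.mono_neutral_right) auto
  finally show "(D * X) $$ (a, b) = D $$ (a, a) * X $$ (a, b)" by simp
  have "(X * D) $$ (a, b) = (\<Sum>c\<in>{0..<n}. X $$ (a, c) * D $$ (c, b))"
    using assms by (simp add: scalar_prod_def)
  also have "\<dots> = (\<Sum>c\<in>{b}. X $$ (a, c) * D $$ (c, b))"
    using assms z by (intro sum.mono_neutral_right) auto
  finally show "(X * D) $$ (a, b) = X $$ (a, b) * D $$ (b, b)" by simp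
qed

lemma upper_left_block_dims [simp]:
  "dim_row (upper_left_block X i) = i" "dim_col (upper_left_block X i) = i"
  by (simp_all add: upper_left_block_def)

lemma upper_left_block_carrier [simp]: "upper_left_block X i \<in> carrier_mat i i"
  by (rule carrier_matI) simp_all

lemma upper_left_block_index:
  "a < i \<Longrightarrow> b < i \<Longrightarrow> upper_left_block X i $$ (a, b) = X $$ (a, b)"
  by (simp add: upper_left_block_def)

text \<open>Passing to a principal block does not respect general products. With a diagonal factor,
  each entry of the product is a single term whose indices stay inside the block.\<close>

lemma upper_left_block_diagonal_mult:
  assumes D: "D \<in> carrier_mat n n" "diagonal_mat D" and X: "X \<in> carrier_mat n n" and i: "i \<le> n"
  shows "upper_left_block (D * X) i = upper_left_block D i * upper_left_block X i"
    and "upper_left_block (X * D) i = upper_left_block X i * upper_left_block D i"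
proof -
  have d: "diagonal_mat (upper_left_block D i)"
    using D i by (auto simp: diagonal_mat_def upper_left_block_def)
  note idx = upper_left_block_index mult_diagonal_mat_index[OF D X]
    mult_diagonal_mat_index[OF upper_left_block_carrier d upper_left_block_carrier]
  show "upper_left_block (D * X) i = upper_left_block D i * upper_left_block X i"
    using i by (intro eq_matI) (auto simp: idx simp del: index_mult_mat(1))
  show "upper_left_block (X * D) i = upper_left_block X i * upper_left_block D i"
    using i by (intro eq_matI) (auto simp: idx simp del: index_mult_mat(1))
qed

text \<open>Conjugation of \<open>X\<close> by \<open>D\<close> in the torus restricts to
  conjugation of its block by the block \<open>E\<close> of \<open>D\<close>, which is again
  unitary.\<close>

lemma GT_hamiltonian_class:
  assumes X: "X \<in> diag_slice m n r \<Lambda>" and i: "i \<le> n"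
  shows "GT_hamiltonian i j (torus_rel m n r \<Lambda> `` {X}) =
    nth_largest_eigenvalue (upper_left_block X i) j"
proof -
  let ?f = "\<lambda>X. nth_largest_eigenvalue (upper_left_block X i) j"
  have Xc: "X \<in> carrier_mat n n" using X by (auto simp: diag_slice_def grassmannian_orbit_def)
  have "?f Y = ?f X" if "(X, Y) \<in> torus_rel m n r \<Lambda>" for Y
  proof -
    obtain D where D: "D \<in> torus n" and Y: "Y = D * X * mat_adjoint D"
      using \<open>(X, Y) \<in> torus_rel m n r \<Lambda>\<close> by (auto simp: torus_rel_def)
    have d: "diagonal_mat D" "diagonal_mat (mat_adjoint D)"
      using D by (auto simp: torus_def diagonal_adjoint)
    have "D \<in> unitary_mats n" using D by (simp add: torus_def)
    note Dm = unitary_matsD[OF this]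
    define E where "E = upper_left_block D i"
    have Ea: "upper_left_block (mat_adjoint D) i = mat_adjoint E"
      using i Dm(1) by (intro eq_matI) (auto simp: E_def upper_left_block_def)
    \<comment> \<open>Unitarity of \<open>E\<close> is the block of the equation
      \<open>mat_adjoint D * D = 1\<close>.\<close>
    have "mat_adjoint E * E = upper_left_block (1\<^sub>m n) i"
      unfolding Dm(3)[symmetric] upper_left_block_diagonal_mult(1)[OF Dm(2) d(2) Dm(1) i] Ea E_def ..
    also have "\<dots> = 1\<^sub>m i" using i by (intro eq_matI) (auto simp: upper_left_block_def)
    finally have E: "E \<in> unitary_mats i" by (simp add: unitary_mats_def E_def)
    have "upper_left_block Y i = E * upper_left_block X i * mat_adjoint E"
      unfolding Y upper_left_block_diagonal_mult(2)[OF Dm(2) d(2) mult_carrier_mat[OF Dm(1) Xc] i]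
        upper_left_block_diagonal_mult(1)[OF Dm(1) d(1) Xc i] Ea E_def ..
    then show ?thesis
      using similar_mat_unitary_conj[OF E upper_left_block_carrier]
      by (simp add: nth_largest_eigenvalue_similar)
  qed
  moreover have "(X, X) \<in> torus_rel m n r \<Lambda>"
    using equiv_torus_rel[of m n r \<Lambda>] X by (rule equiv_class_self[unfolded Image_singleton_iff])
  ultimately have "?f ` (torus_rel m n r \<Lambda> `` {X}) = {?f X}" by blast
  then show ?thesis by (simp add: GT_hamiltonian_def)
qed

section \<open>Gram matrices, blocks and partial sums of a frame\<close>

lemma char_poly_smult_one: "char_poly (c \<cdot>\<^sub>m 1\<^sub>m k :: 'a :: idom mat) = [:- c, 1:] ^ k"
proof -
  have "diag_mat (c \<cdot>\<^sub>m 1\<^sub>m k) = replicate k c"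
    by (rule nth_equalityI) (auto simp: diag_mat_def)
  moreover have "upper_triangular (c \<cdot>\<^sub>m 1\<^sub>m k)" by auto
  ultimately show ?thesis
    using char_poly_upper_triangular[of "c \<cdot>\<^sub>m 1\<^sub>m k" k] by simp
qed

text \<open>Ensures that \<open>pi2\<close> of a frame is a genuine class: \<open>torus_rel\<close>
  relates only members of the slice. The spectrum comes from that of the scalar matrix
  \<open>N * mat_adjoint N\<close> by exchanging the factors, and the diagonal entries are the
  squared column norms.\<close>

lemma frame_mats_gram_diag_slice:
  assumes N: "N \<in> frame_mats m n r \<Lambda>" and mn: "m + 1 \<le> n"
  shows "mat_adjoint N * N \<in> diag_slice m n r \<Lambda>"
proof -
  let ?X = "mat_adjoint N * N"
  have Nc: "N \<in> carrier_mat (Suc m) n"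
    and cn: "\<And>j. j < n \<Longrightarrow> col N j \<bullet>c col N j = complex_of_real (r j)"
    and NN: "N * mat_adjoint N = complex_of_real \<Lambda> \<cdot>\<^sub>m 1\<^sub>m (Suc m)"
    using N by (auto simp: frame_mats_def)
  have Na: "mat_adjoint N \<in> carrier_mat n (Suc m)" using mat_adjoint_carrier[of N] Nc by auto
  have "proots (char_poly ?X) + replicate_mset (Suc m) 0 =
      replicate_mset (Suc m) (complex_of_real \<Lambda>) + replicate_mset n 0"
    unfolding proots_char_poly_mult_commute[OF Na Nc] NN char_poly_smult_one proots_power
    by (simp del: replicate_mset_Suc)
  also have "replicate_mset n (0 :: complex) = replicate_mset (n - m - 1) 0 + replicate_mset (Suc m) 0"
    using replicate_mset_diff[of "Suc m" n "0 :: complex", symmetric] mn by simp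
  finally have "proots (char_poly ?X) =
      replicate_mset (m + 1) (complex_of_real \<Lambda>) + replicate_mset (n - m - 1) 0"
    by (simp del: replicate_mset_Suc flip: add.assoc)
  moreover have "mat_adjoint ?X = ?X" by (simp add: mat_adjoint_mult[OF Na Nc])
  moreover have "?X $$ (j, j) = complex_of_real (r j)" if "j < n" for j
    using that Nc by (simp flip: cn add: scalar_prod_def mult.commute)
  ultimately show ?thesis
    using Nc Na by (simp add: diag_slice_def grassmannian_orbit_def)
qed

text \<open>Each column contributes one summand to the product, so cutting the polygon after
  \<open>i\<close> edges amounts to cutting the matrix after \<open>i\<close> columns.\<close>

lemma mat_sum_list_take_tensor_cols:
  assumes "N \<in> carrier_mat k n" and "i \<le> n"
  defines "B \<equiv> mat k i (\<lambda>(a, b). N $$ (a, b))"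
  shows "mat_sum_list k (take i (map (\<lambda>j. tensor_star (col N j)) [0..<n])) = B * mat_adjoint B"
proof -
  have "col N j = col B j" if "j < i" for j
    using assms that by (intro eq_vecI) auto
  then have "take i (map (\<lambda>j. tensor_star (col N j)) [0..<n]) =
      map (\<lambda>j. tensor_star (col B j)) [0..<i]"
    using \<open>i \<le> n\<close> by (simp add: take_map)
  then show ?thesis using mat_sum_list_tensor_cols[of B k i] by (simp add: B_def)
qed

lemma upper_left_block_gram:
  assumes "N \<in> carrier_mat k n" and "i \<le> n"
  defines "B \<equiv> mat k i (\<lambda>(a, b). N $$ (a, b))"
  shows "upper_left_block (mat_adjoint N * N) i = mat_adjoint B * B"
  using assms by (intro eq_matI) (auto simp: upper_left_block_def scalar_prod_def)

theorem proposition8p4: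
  fixes m n :: nat and r :: "nat \<Rightarrow> real" and \<Lambda> :: real
  assumes "m \<ge> 1" and "n \<ge> m + 1"
    and "\<forall>i<n. r i > 0"
    and "\<Lambda> = (\<Sum>i<n. r i) / (real m + 1)"
  shows "\<forall>i j. i \<le> n - 1 \<longrightarrow> 1 \<le> j \<longrightarrow> j \<le> min (i + 1) (m + 1) \<longrightarrow>
    (\<forall>p \<in> polygon_moduli m n r \<Lambda>.
       GT_hamiltonian (i + 1) j (GM_duality m n r \<Lambda> p) = bending_hamiltonian m i j p)"
proof (intro allI impI ballI)
  fix i j p
  assume i: "i \<le> n - 1" and j: "1 \<le> j" "j \<le> min (i + 1) (m + 1)"
    and p: "p \<in> polygon_moduli m n r \<Lambda>"
  \<comment> \<open>Surjectivity of \<open>pi1\<close>, which rests on the positivity of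
    \<open>r\<close>, gives a frame \<open>N\<close> over \<open>p\<close>. Both Hamiltonians can
    then be evaluated on representatives built from \<open>N\<close>.\<close>
  obtain N where N: "N \<in> frame_mats m n r \<Lambda>" and pN: "p = pi1 m n r \<Lambda> N"
    using p pi1_image[OF assms(3)] by blast
  have Nc: "N \<in> carrier_mat (Suc m) n" using N by (simp add: frame_mats_def)
  \<comment> \<open>Subtraction on naturals truncates; \<open>n\<close> is positive, so the first
    \<open>i + 1\<close> columns exist.\<close>
  have i': "Suc i \<le> n" using i assms(1,2) by linarith
  define B where "B = mat (Suc m) (Suc i) (\<lambda>(a, b). N $$ (a, b))"
  have "GT_hamiltonian (i + 1) j (GM_duality m n r \<Lambda> p) =
      nth_largest_eigenvalue (mat_adjoint B * B) j"
    using GT_hamiltonian_class[OF frame_mats_gram_diag_slice[OF N assms(2)] i', of j]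
    unfolding upper_left_block_gram[OF Nc i'] B_def pN GM_duality_pi1[OF N assms(3)]
    by (simp add: pi2_def)
  \<comment> \<open>The bound on \<open>j\<close> is exactly the range in which both Gram matrices,
    of sizes \<open>i + 1\<close> and \<open>m + 1\<close>, have a \<open>j\<close>-th
    eigenvalue.\<close>
  also have "\<dots> = nth_largest_eigenvalue (B * mat_adjoint B) j"
    using j by (intro nth_largest_eigenvalue_gram[of B "Suc m" "Suc i"]) (auto simp: B_def)
  also have "\<dots> = bending_hamiltonian m i j p"
    unfolding pN pi1_def bending_hamiltonian_class[OF frame_mats_closed_polygon[OF N assms(3)]]
      mat_sum_list_take_tensor_cols[OF Nc i'] B_def ..
  finally show "GT_hamiltonian (i + 1) j (GM_duality m n r \<Lambda> p) = bending_hamiltonian m i j p" .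
qed

end
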